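(* Let $\|\cdot\|$ be any norm on $\mathbb{R}^n$. For any $\epsilon>0$, there exist an even integer $d$ and a convex positive definite form $f$ of degree $d$ in $n$ variables such that $$\max_{x\in S^{n-1}}\big|f^{1/d}(x)-\|x\|\big|\le\epsilon .$$
   Context: A form is a homogeneous polynomial; it is positive definite if it is positive at every nonzero point. $S^{n-1}$ denotes the Euclidean unit sphere in $\mathbb{R}^n$. *)

theory Defs
  imports "HOL-Analysis.Analysis"
begin

text \<open>
  The class function \<open>norm\<close> on \<^typ>\<open>real^'n\<close> is the Euclidean one, so an arbitrary
  norm is a function satisfying the norm axioms.
\<close>
definition is_norm :: "('a::real_vector \<Rightarrow> real) \<Rightarrow> bool" where
  "is_norm N \<longleftrightarrow>
     (\<forall>x. 0 \<le> N x) \<and>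
     (\<forall>x. N x = 0 \<longleftrightarrow> x = 0) \<and>
     (\<forall>c x. N (c *\<^sub>R x) = \<bar>c\<bar> * N x) \<and>
     (\<forall>x y. N (x + y) \<le> N x + N y)"

text \<open>
  A form of degree \<open>d\<close> is a linear combination of the monomials whose exponent vector
  \<open>\<alpha>\<close> has total degree \<open>d\<close>; over the reals it is identified with its polynomial function.
\<close>
definition is_form :: "nat \<Rightarrow> (real^'n \<Rightarrow> real) \<Rightarrow> bool" where
  "is_form d f \<longleftrightarrow>
     (\<exists>c :: ('n \<Rightarrow> nat) \<Rightarrow> real. \<forall>x.
        f x = (\<Sum>\<alpha> | sum \<alpha> UNIV = d. c \<alpha> * (\<Prod>i\<in>UNIV. (x $ i) ^ \<alpha> i)))"

text \<open>The index set of the sum above is finite, so the sum is never the default value.\<close>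
lemma finite_exponents: "finite {\<alpha> :: 'n::finite \<Rightarrow> nat. sum \<alpha> UNIV = d}"
proof (rule finite_subset)
  show "{\<alpha> :: 'n \<Rightarrow> nat. sum \<alpha> UNIV = d} \<subseteq> (UNIV :: 'n set) \<rightarrow>\<^sub>E {..d}"
    by (auto simp: PiE_def intro: member_le_sum)
  show "finite ((UNIV :: 'n set) \<rightarrow>\<^sub>E {..d})"
    by (rule finite_PiE) auto
qed

definition positive_definite :: "(real^'n \<Rightarrow> real) \<Rightarrow> bool" where
  "positive_definite f \<longleftrightarrow> (\<forall>x. x \<noteq> 0 \<longrightarrow> 0 < f x)"

definition has_max_on :: "('a \<Rightarrow> real) \<Rightarrow> 'a set \<Rightarrow> real \<Rightarrow> bool" where
  "has_max_on g S m \<longleftrightarrow> (\<exists>x\<in>S. g x = m) \<and> (\<forall>x\<in>S. g x \<le> m)"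

end

theory Submission
  imports Defs
begin

text \<open>
  A norm is the supremum of the linear functionals \<open>v \<bullet> x\<close> that it dominates. Since the unit
  sphere is compact, finitely many of them, forming a set \<open>V\<close>, already reach
  \<open>(1 - \<delta>) * N x\<close> at every \<open>x\<close> (\<open>finite_norming_set\<close>). The maximum over \<open>V\<close> need not be a root of
  a polynomial, but it is the limit of \<open>d\<close>-norms: for even \<open>d\<close> the form
  \<open>f x = (\<Sum>v\<in>V. (v \<bullet> x) ^ d)\<close> satisfies
  \[ ((1 - \<delta>) N(x))^d \le f(x) \le |V| \, N(x)^d, \]
  and \<open>|V|\<close> is at most \<open>(1 + \<delta>) ^ d\<close> once \<open>d\<close> is large. Hence the \<open>d\<close>-th root of \<open>f\<close> lies within
  the relative error \<open>\<delta>\<close> of \<open>N\<close> (\<open>norm_approx_by_convex_form\<close>). Convexity of \<open>f\<close> comes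
  for free, as \<open>f\<close> is a sum of even powers of linear functionals; the lower bound gives
  positive definiteness. As \<open>N\<close> is bounded on the sphere, a small relative error is a small
  absolute error there.
\<close>

section \<open>Algebra of forms\<close>

lemma is_form_0: "is_form d (\<lambda>x. 0)"
  unfolding is_form_def by (rule exI[of _ "\<lambda>_. 0"]) simp

lemma is_form_add:
  assumes "is_form d f" "is_form d g"
  shows "is_form d (\<lambda>x. f x + g x)"
proof -
  obtain a where a: "\<And>x. f x = (\<Sum>\<alpha> | sum \<alpha> UNIV = d. a \<alpha> * (\<Prod>i\<in>UNIV. (x $ i) ^ \<alpha> i))"
    using assms(1) unfolding is_form_def by blast
  obtain b where b: "\<And>x. g x = (\<Sum>\<alpha> | sum \<alpha> UNIV = d. b \<alpha> * (\<Prod>i\<in>UNIV. (x $ i) ^ \<alpha> i))"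
    using assms(2) unfolding is_form_def by blast
  show ?thesis
    unfolding is_form_def
    by (rule exI[of _ "\<lambda>\<alpha>. a \<alpha> + b \<alpha>"]) (simp add: a b sum.distrib distrib_right)
qed

lemma is_form_sum:
  "(\<And>v. v \<in> V \<Longrightarrow> is_form d (f v)) \<Longrightarrow> is_form d (\<lambda>x. \<Sum>v\<in>V. f v x)"
  by (induction V rule: infinite_finite_induct) (auto intro: is_form_0 is_form_add)

text \<open>
  Multiplying out gives one term for each pair of exponents; the coefficient of the product
  at \<open>\<gamma>\<close> collects the pairs that add up to \<open>\<gamma>\<close>.
\<close>
lemma is_form_mult:
  fixes f g :: "real^'n \<Rightarrow> real"
  assumes "is_form d f" "is_form e g"
  shows "is_form (d + e) (\<lambda>x. f x * g x)"
proof -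
  let ?E = "\<lambda>k. {\<alpha> :: 'n \<Rightarrow> nat. sum \<alpha> UNIV = k}"
  let ?m = "\<lambda>\<alpha> (x :: real^'n). \<Prod>i\<in>UNIV. (x $ i) ^ \<alpha> i"
  let ?plus = "\<lambda>p :: ('n \<Rightarrow> nat) \<times> ('n \<Rightarrow> nat). \<lambda>i. fst p i + snd p i"
  obtain a where a: "\<And>x. f x = (\<Sum>\<alpha>\<in>?E d. a \<alpha> * ?m \<alpha> x)"
    using assms(1) unfolding is_form_def by blast
  obtain b where b: "\<And>x. g x = (\<Sum>\<alpha>\<in>?E e. b \<alpha> * ?m \<alpha> x)"
    using assms(2) unfolding is_form_def by blast
  let ?P = "?E d \<times> ?E e"
  define c where "c \<gamma> = (\<Sum>p\<in>{p \<in> ?P. ?plus p = \<gamma>}. a (fst p) * b (snd p))" for \<gamma>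
  have fin: "finite ?P"
    by (simp add: finite_exponents)
  have img: "?plus ` ?P \<subseteq> ?E (d + e)"
    by (auto simp: sum.distrib)
  have "f x * g x = (\<Sum>\<gamma>\<in>?E (d + e). c \<gamma> * ?m \<gamma> x)" for x
  proof -
    have "f x * g x = (\<Sum>p\<in>?P. a (fst p) * b (snd p) * ?m (?plus p) x)"
      by (simp add: a b sum_product sum.cartesian_product power_add prod.distrib
          case_prod_beta mult_ac)
    also have "\<dots> = (\<Sum>\<gamma>\<in>?E (d + e). \<Sum>p\<in>{p \<in> ?P. ?plus p = \<gamma>}.
        a (fst p) * b (snd p) * ?m (?plus p) x)"
      by (rule sum.group[OF fin finite_exponents img, symmetric])
    also have "\<dots> = (\<Sum>\<gamma>\<in>?E (d + e). c \<gamma> * ?m \<gamma> x)"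
      unfolding c_def sum_distrib_right by (intro sum.cong refl) auto
    finally show ?thesis .
  qed
  then show ?thesis
    unfolding is_form_def by blast
qed

lemma is_form_const: "is_form 0 (\<lambda>x :: real^'n. k)"
proof -
  have "{\<alpha> :: 'n \<Rightarrow> nat. sum \<alpha> UNIV = 0} = {\<lambda>_. 0}"
    by (auto simp: fun_eq_iff)
  then show ?thesis
    unfolding is_form_def by (intro exI[of _ "\<lambda>_. k"]) simp
qed

lemma is_form_component: "is_form 1 (\<lambda>x :: real^'n. x $ j)"
proof -
  let ?u = "\<lambda>i. if i = j then 1 else 0 :: nat"
  have "x $ j = (\<Sum>\<alpha> | sum \<alpha> UNIV = 1.
      (if \<alpha> = ?u then 1 else 0) * (\<Prod>i\<in>UNIV. (x $ i) ^ \<alpha> i))" for x :: "real^'n"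
  proof -
    have "(\<Sum>\<alpha> | sum \<alpha> UNIV = 1. (if \<alpha> = ?u then 1 else 0) * (\<Prod>i\<in>UNIV. (x $ i) ^ \<alpha> i))
        = (\<Sum>\<alpha> | sum \<alpha> UNIV = 1. if \<alpha> = ?u then \<Prod>i\<in>UNIV. (x $ i) ^ \<alpha> i else 0)"
      by (intro sum.cong) auto
    also have "\<dots> = (\<Prod>i\<in>UNIV. (x $ i) ^ ?u i)"
      by (subst sum.delta) (simp_all add: finite_exponents[simplified])
    also have "\<dots> = (\<Prod>i\<in>UNIV. if i = j then x $ i else 1)"
      by (intro prod.cong) auto
    also have "\<dots> = x $ j"
      by simp
    finally show ?thesis by simp
  qed
  then show ?thesis
    unfolding is_form_def by (intro exI[of _ "\<lambda>\<alpha>. if \<alpha> = ?u then 1 else 0"]) blast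
qed

lemma is_form_inner: "is_form 1 (\<lambda>x :: real^'n. v \<bullet> x)"
proof -
  have "is_form (0 + 1) (\<lambda>x :: real^'n. v $ j * x $ j)" for j
    by (intro is_form_mult is_form_const is_form_component)
  then show ?thesis
    by (auto simp: inner_vec_def intro!: is_form_sum)
qed

lemma is_form_power:
  assumes "is_form d f"
  shows "is_form (k * d) (\<lambda>x. f x ^ k)"
  by (induction k) (auto intro: is_form_const is_form_mult assms)

section \<open>Convexity of sums of even powers\<close>

lemma convex_on_inner_power_even:
  fixes v :: "'a::real_inner"
  assumes "even d"
  shows "convex_on UNIV (\<lambda>x. (v \<bullet> x) ^ d)"
proof (rule convex_onI)
  fix t :: real and x y :: 'a
  assume t: "0 < t" "t < 1"
  show "(v \<bullet> ((1 - t) *\<^sub>R x + t *\<^sub>R y)) ^ d \<le> (1 - t) * (v \<bullet> x) ^ d + t * (v \<bullet> y) ^ d"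
    using convex_onD[OF convex_power_even[OF assms], of t "v \<bullet> x" "v \<bullet> y"] t
    by (simp add: inner_add_right)
qed simp

lemma convex_on_sum_functions:
  assumes "\<And>v. v \<in> V \<Longrightarrow> convex_on UNIV (f v)"
  shows "convex_on UNIV (\<lambda>x. \<Sum>v\<in>V. f v x)"
  using assms
  by (induction V rule: infinite_finite_induct) (auto simp: convex_on_const)

section \<open>Functionals dominated by a norm\<close>

lemma is_norm_scale: "is_norm N \<Longrightarrow> N (c *\<^sub>R x) = \<bar>c\<bar> * N x"
  by (simp add: is_norm_def)

lemma is_norm_nonneg: "is_norm N \<Longrightarrow> 0 \<le> N x"
  by (simp add: is_norm_def)

lemma is_norm_triangle: "is_norm N \<Longrightarrow> N (x + y) \<le> N x + N y"
  by (simp add: is_norm_def)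

lemma is_norm_zero: "is_norm N \<Longrightarrow> N 0 = 0"
  by (simp add: is_norm_def)

lemma is_norm_pos: "is_norm N \<Longrightarrow> x \<noteq> 0 \<Longrightarrow> 0 < N x"
  by (metis is_norm_def order_le_less)

lemma is_norm_convex_on:
  assumes "is_norm N"
  shows "convex_on UNIV N"
proof (rule convex_onI)
  fix t :: real and x y
  assume t: "0 < t" "t < 1"
  have "N ((1 - t) *\<^sub>R x + t *\<^sub>R y) \<le> N ((1 - t) *\<^sub>R x) + N (t *\<^sub>R y)"
    by (rule is_norm_triangle[OF assms])
  then show "N ((1 - t) *\<^sub>R x + t *\<^sub>R y) \<le> (1 - t) * N x + t * N y"
    using t by (simp add: is_norm_scale[OF assms])
qed simp

lemma is_norm_continuous_on:
  fixes N :: "'a::euclidean_space \<Rightarrow> real"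
  assumes "is_norm N"
  shows "continuous_on S N"
  using convex_on_continuous[OF open_UNIV is_norm_convex_on[OF assms]]
    continuous_on_subset by blast

text \<open>
  Hahn--Banach in geometric form: the multiple of \<open>x\<close> of norm \<open>1 / (1 - \<delta>)\<close> lies outside the
  closed unit ball of \<open>N\<close>, so a hyperplane separates the two strictly. Written as
  \<open>{y. v \<bullet> y = 1}\<close>, this hyperplane has the desired functional as its normal vector.
\<close>
lemma norming_functional:
  fixes N :: "'a::euclidean_space \<Rightarrow> real"
  assumes N: "is_norm N" and x: "x \<noteq> 0" and \<delta>: "0 < \<delta>" "\<delta> < 1"
  obtains v where "\<And>y. \<bar>v \<bullet> y\<bar> \<le> N y" "(1 - \<delta>) * N x < v \<bullet> x"
proof -
  let ?B = "{y. N y \<le> 1}"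
  define r where "r = (1 - \<delta>) * N x"
  have r: "0 < r"
    using is_norm_pos[OF N x] \<delta> by (simp add: r_def)
  have "convex ?B"
  proof (rule convexI)
    fix y z and s t :: real
    assume *: "y \<in> ?B" "z \<in> ?B" "0 \<le> s" "0 \<le> t" "s + t = 1"
    have "N (s *\<^sub>R y + t *\<^sub>R z) \<le> N (s *\<^sub>R y) + N (t *\<^sub>R z)"
      by (rule is_norm_triangle[OF N])
    also have "\<dots> \<le> 1"
      using * by (simp add: is_norm_scale[OF N] convex_bound_le)
    finally show "s *\<^sub>R y + t *\<^sub>R z \<in> ?B" by simp
  qed
  moreover have "closed ?B"
    by (intro closed_Collect_le is_norm_continuous_on[OF N] continuous_intros)
  moreover have "(1 / r) *\<^sub>R x \<notin> ?B"
  proof -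
    have "r < N x"
      using \<delta> is_norm_pos[OF N x] by (simp add: r_def)
    then show ?thesis
      using r by (simp add: is_norm_scale[OF N])
  qed
  ultimately have "\<exists>a b. a \<bullet> ((1 / r) *\<^sub>R x) < b \<and> (\<forall>y\<in>?B. b < a \<bullet> y)"
    by (rule separating_hyperplane_closed_point)
  then obtain a b where ab: "a \<bullet> ((1 / r) *\<^sub>R x) < b" "\<And>y. y \<in> ?B \<Longrightarrow> b < a \<bullet> y"
    by blast
  \<comment> \<open>The origin lies in the ball, hence on the side where \<open>a \<bullet> y\<close> exceeds \<open>b\<close>; dividing by \<open>b\<close>
    therefore reverses both inequalities.\<close>
  have b: "b < 0"
    using ab(2)[of 0] is_norm_zero[OF N] by simp
  define v where "v = (1 / b) *\<^sub>R a"
  have ball: "v \<bullet> y \<le> 1" if "N y \<le> 1" for y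
    using ab(2)[of y] that b by (simp add: v_def field_simps)
  have le: "v \<bullet> y \<le> N y" for y
  proof (cases "y = 0")
    case False
    have pos: "0 < N y"
      using is_norm_pos[OF N False] .
    have "v \<bullet> ((1 / N y) *\<^sub>R y) \<le> 1"
      by (rule ball) (use pos in \<open>simp add: is_norm_scale[OF N]\<close>)
    then show ?thesis
      using pos by (simp add: field_simps)
  qed (simp add: is_norm_zero[OF N])
  have "\<bar>v \<bullet> y\<bar> \<le> N y" for y
    using le[of y] le[of "- y"] is_norm_scale[OF N, of "- 1" y] by simp
  moreover have "r < v \<bullet> x"
    using ab(1) b r by (simp add: v_def field_simps)
  ultimately show ?thesis
    unfolding r_def by (rule that)
qed

text \<open>
  The functionals found at the points of the sphere stay good in a neighbourhood, so
  compactness leaves finitely many; homogeneity carries the bound from the sphere to all of space.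
\<close>
lemma finite_norming_set:
  fixes N :: "'a::euclidean_space \<Rightarrow> real"
  assumes N: "is_norm N" and \<delta>: "0 < \<delta>" "\<delta> < 1"
  obtains V where "finite V" "\<And>v y. v \<in> V \<Longrightarrow> \<bar>v \<bullet> y\<bar> \<le> N y"
    "\<And>x. x \<noteq> 0 \<Longrightarrow> \<exists>v\<in>V. (1 - \<delta>) * N x < v \<bullet> x"
proof -
  let ?D = "{v. \<forall>y. \<bar>v \<bullet> y\<bar> \<le> N y}"
  let ?U = "\<lambda>v. {x. (1 - \<delta>) * N x < v \<bullet> x}"
  have opn: "open (?U v)" for v
    by (intro open_Collect_less continuous_intros is_norm_continuous_on[OF N])
  have cover: "sphere 0 1 \<subseteq> (\<Union>v\<in>?D. ?U v)"
  proof
    fix x :: 'a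
    assume "x \<in> sphere 0 1"
    then have "x \<noteq> 0" by auto
    then obtain v where "\<And>y. \<bar>v \<bullet> y\<bar> \<le> N y" "(1 - \<delta>) * N x < v \<bullet> x"
      using norming_functional[OF N _ \<delta>] by blast
    then show "x \<in> (\<Union>v\<in>?D. ?U v)" by blast
  qed
  obtain V where V: "V \<subseteq> ?D" "finite V" "sphere 0 1 \<subseteq> (\<Union>v\<in>V. ?U v)"
    by (rule compactE_image[OF compact_sphere opn cover])
  have "\<exists>v\<in>V. (1 - \<delta>) * N x < v \<bullet> x" if "x \<noteq> 0" for x
  proof -
    have "(1 / norm x) *\<^sub>R x \<in> sphere 0 1"
      using that by simp
    then obtain v where "v \<in> V" "(1 - \<delta>) * N ((1 / norm x) *\<^sub>R x) < v \<bullet> ((1 / norm x) *\<^sub>R x)"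
      using V(3) by blast
    then have "v \<in> V" "((1 - \<delta>) * N x) / norm x < (v \<bullet> x) / norm x"
      by (simp_all add: is_norm_scale[OF N])
    then have "(1 - \<delta>) * N x < v \<bullet> x"
      using that by (simp add: divide_less_cancel)
    with \<open>v \<in> V\<close> show ?thesis by blast
  qed
  with V show ?thesis
    by (intro that[of V]) auto
qed

section \<open>Approximation by convex forms\<close>

text \<open>
  The bound is relative because the argument is homogeneous: one good functional in \<open>V\<close> gives
  the lower estimate, and the upper one loses only the factor \<open>card V\<close>, whose \<open>d\<close>-th root
  tends to \<open>1\<close>. The set \<open>V\<close> depends only on \<open>N\<close> and \<open>\<delta>\<close>, so \<open>d\<close> can be chosen after it.
\<close>
lemma norm_approx_by_convex_form:
  fixes N :: "real^'n \<Rightarrow> real"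
  assumes N: "is_norm N" and \<delta>: "0 < \<delta>" "\<delta> < 1"
  obtains d f where "0 < d" "even d" "is_form d f" "convex_on UNIV f"
    "\<And>x. (1 - \<delta>) * N x \<le> root d (f x)" "\<And>x. root d (f x) \<le> (1 + \<delta>) * N x"
proof -
  obtain V where V: "finite V" "\<And>v y. v \<in> V \<Longrightarrow> \<bar>v \<bullet> y\<bar> \<le> N y"
    "\<And>x. x \<noteq> 0 \<Longrightarrow> \<exists>v\<in>V. (1 - \<delta>) * N x < v \<bullet> x"
    by (rule finite_norming_set[OF N \<delta>]) (rule that)
  obtain n where n: "real (card V) < (1 + \<delta>) ^ n"
    using real_arch_pow[of "1 + \<delta>"] \<delta> by auto
  \<comment> \<open>The successor keeps the degree positive, doubling makes it even.\<close>
  define d where "d = 2 * Suc n"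
  define f where "f x = (\<Sum>v\<in>V. (v \<bullet> x) ^ d)" for x
  have d: "0 < d" "even d"
    by (auto simp: d_def)
  have "(1 + \<delta>) ^ n \<le> (1 + \<delta>) ^ d"
    using \<delta> by (intro power_increasing) (auto simp: d_def)
  then have card: "real (card V) \<le> (1 + \<delta>) ^ d"
    using n by simp
  have form: "is_form d f"
    unfolding f_def using is_form_power[OF is_form_inner, of d]
    by (intro is_form_sum) simp
  have convex: "convex_on UNIV f"
    unfolding f_def using d by (intro convex_on_sum_functions convex_on_inner_power_even)
  have lower: "(1 - \<delta>) * N x \<le> root d (f x)" for x
  proof (cases "x = 0")
    case True
    then show ?thesis
      using d by (simp add: is_norm_zero[OF N] f_def)
  next
    case False
    then obtain v where v: "v \<in> V" "(1 - \<delta>) * N x < v \<bullet> x"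
      using V(3) by blast
    have nonneg: "0 \<le> (1 - \<delta>) * N x"
      using \<delta> is_norm_nonneg[OF N] by simp
    have "((1 - \<delta>) * N x) ^ d \<le> (v \<bullet> x) ^ d"
      using v nonneg by (intro power_mono) auto
    also have "\<dots> \<le> f x"
      unfolding f_def using v V(1) d by (intro member_le_sum) (auto simp: zero_le_even_power)
    finally have "root d (((1 - \<delta>) * N x) ^ d) \<le> root d (f x)"
      using d by simp
    then show ?thesis
      using d nonneg by (simp only: real_root_power_cancel)
  qed
  have upper: "root d (f x) \<le> (1 + \<delta>) * N x" for x
  proof -
    have nonneg: "0 \<le> (1 + \<delta>) * N x"
      using \<delta> is_norm_nonneg[OF N] by simp
    have "(v \<bullet> x) ^ d \<le> N x ^ d" if "v \<in> V" for v
      using power_mono[OF V(2)[OF that, of x], of d] d by (simp add: power_even_abs)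
    then have "f x \<le> real (card V) * N x ^ d"
      unfolding f_def by (rule sum_bounded_above)
    also have "\<dots> \<le> ((1 + \<delta>) * N x) ^ d"
      using card is_norm_nonneg[OF N] by (simp add: power_mult_distrib mult_right_mono)
    finally have "root d (f x) \<le> root d (((1 + \<delta>) * N x) ^ d)"
      using d by simp
    then show ?thesis
      using d nonneg by (simp only: real_root_power_cancel)
  qed
  show ?thesis
    by (rule that[OF d form convex lower upper])
qed

theorem theorem6p3p1:
  fixes N :: "real^'n \<Rightarrow> real" and \<epsilon> :: real
  assumes "is_norm N" and "\<epsilon> > 0"
  shows "\<exists>(d::nat) (f :: real^'n \<Rightarrow> real).
           0 < d \<and> even d \<and> is_form d f \<and> convex_on UNIV f \<and> positive_definite f \<and>
           (\<exists>m. has_max_on (\<lambda>x. \<bar>root d (f x) - N x\<bar>) (sphere 0 1) m \<and> m \<le> \<epsilon>)"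
proof -
  let ?S = "sphere 0 1 :: (real^'n) set"
  have S: "compact ?S" "?S \<noteq> {}"
    by simp_all
  obtain z where z: "z \<in> ?S" "\<And>x. x \<in> ?S \<Longrightarrow> N x \<le> N z"
    using continuous_attains_sup[OF S is_norm_continuous_on[OF assms(1)]] by blast
  have pos: "0 < N z"
    using z(1) by (intro is_norm_pos[OF assms(1)]) auto
  \<comment> \<open>The second argument makes the absolute error at most \<open>\<epsilon>\<close> on the sphere; the first keeps
    \<open>\<delta>\<close> below \<open>1\<close>, as positive definiteness needs \<open>1 - \<delta> > 0\<close>.\<close>
  define \<delta> where "\<delta> = min (1 / 2) (\<epsilon> / N z)"
  have \<delta>: "0 < \<delta>" "\<delta> < 1" "\<delta> * N z \<le> \<epsilon>"
    using pos assms(2) by (auto simp: \<delta>_def min_def field_simps)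
  obtain d f where df: "0 < d" "even d" "is_form d f" "convex_on UNIV f"
    and lower: "\<And>x. (1 - \<delta>) * N x \<le> root d (f x)"
    and upper: "\<And>x. root d (f x) \<le> (1 + \<delta>) * N x"
    using norm_approx_by_convex_form[OF assms(1) \<delta>(1,2)] by blast
  have "positive_definite f"
    unfolding positive_definite_def
  proof (intro allI impI)
    fix x :: "real^'n"
    assume "x \<noteq> 0"
    then have "0 < (1 - \<delta>) * N x"
      using is_norm_pos[OF assms(1)] \<delta>(2) by simp
    then have "0 < root d (f x)"
      using lower[of x] by linarith
    then show "0 < f x"
      using df(1) by simp
  qed
  moreover have "\<exists>m. has_max_on (\<lambda>x. \<bar>root d (f x) - N x\<bar>) ?S m \<and> m \<le> \<epsilon>"
  proof -
    have bound: "\<bar>root d (f x) - N x\<bar> \<le> \<epsilon>" if "x \<in> ?S" for x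
    proof -
      have "\<bar>root d (f x) - N x\<bar> \<le> \<delta> * N x"
        using lower[of x] upper[of x] by (simp add: abs_le_iff algebra_simps)
      also have "\<dots> \<le> \<delta> * N z"
        using z(2)[OF that] \<delta>(1) by (simp add: mult_left_mono)
      finally show ?thesis
        using \<delta>(3) by linarith
    qed
    have "continuous_on ?S f"
      using convex_on_continuous[OF open_UNIV df(4)] continuous_on_subset by blast
    then have "continuous_on ?S (\<lambda>x. \<bar>root d (f x) - N x\<bar>)"
      by (intro continuous_intros is_norm_continuous_on[OF assms(1)])
    from continuous_attains_sup[OF S this] bound show ?thesis
      unfolding has_max_on_def by blast
  qed
  ultimately show ?thesis
    using df by blast
qed

end
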